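(* Let $\mathcal{R}$ be right amenable, let $\mathcal{F} = (F_i)_{i \in I}$ be a right Følner net in $\mathcal{R}$, let $\theta,\kappa,\theta'$ be non-negative integers, let $X$ be a $\kappa$-strongly irreducible subshift of $Q^M$ such that $|X| \geq 2$, let $Y$ be a subset of $X$, and let $T$ be a $(\theta, \kappa, \theta')$-tiling of $\mathcal{R}$ such that, for each element $t \in T$, we have $Y_{\mathbb{B}(t, \theta)} \subsetneqq X_{\mathbb{B}(t, \theta)}$. Then $\mathrm{ent}_{\mathcal{F}}(Y) < \mathrm{ent}_{\mathcal{F}}(X)$.
   Context: Setting. A group $G$ acts transitively from the left on a non-empty set $M$; the action is written $(g,m)\mapsto g\triangleright m$. An element $m_0\in M$ and, for each $m\in M$, an element $g_{m_0,m}\in G$ with $g_{m_0,m}\triangleright m_0=m$ are fixed; $\mathcal{R}=((M,G,\triangleright),(m_0,(g_{m_0,m})_{m\in M}))$ is called a cell space. The stabiliser $G_0$ of $m_0$ is finite. The right semi-action of $G/G_0$ on $M$ is $m\triangleleft gG_0=g_{m_0,m}g\triangleright m_0$. For $A\subseteq M$, $A\triangleleft\mathfrak{g}=\{a\triangleleft\mathfrak{g}: a\in A\}$. $\mathcal{R}$ is finitely right generated, and $S$ is a fixed finite symmetric right generating set: a finite $S\subseteq G/G_0$ with $G_0\cdot S\subseteq S$ and $S^{-1}:=\{g^{-1}G_0: s\in S,\ g\in s\}\subseteq S$ such that each $m\in M$ has the form $(((m_0\triangleleft s_1)\triangleleft s_2)\cdots)\triangleleft s_k$ with $k\ge 0$,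 $s_i\in S$. $d$ is the path metric on $M$ of the graph with an edge from $m$ to $m\triangleleft s$ for $m\in M$, $s\in S$. $\mathbb{B}(m,\rho)=\{m'\in M: d(m,m')\le\rho\}$ for $\rho\in\mathbb{N}_0$. For $A,B\subseteq M$, $d(A,B)=\inf\{d(a,b): a\in A, b\in B\}$ (with $\inf\emptyset=\infty$). For $A\subseteq M$ and $\theta\in\mathbb{N}_0$: $A^{-\theta}=\{m\in A:\mathbb{B}(m,\theta)\subseteq A\}$, $A^{+\theta}=\{m\in M:\mathbb{B}(m,\theta)\cap A\neq\emptyset\}$, $\partial_\theta A=A^{+\theta}\setminus A^{-\theta}$. $H$ is a fixed subgroup of $G$ containing all $g_{m_0,m}$, $m\in M$. $Q$ is a finite set. A subset $T\subseteq M$ is a $(\theta,\kappa,\theta')$-tiling of $\mathcal{R}$ if $d(\mathbb{B}(t,\theta),\mathbb{B}(t',\theta))\ge\kappa+1$ for all distinct $t,t'\in T$ and $\bigcup_{t\in T}\mathbb{B}(t,\theta')=M$. Patterns and subshifts. For $A\subseteq M$, an $A$-pattern is a map $p\colon A\to Q$, with domain $\mathrm{dom}(p)=A$; it is finite if $A$ is finite. For $g\in G$, $g\blacktriangleright p\colon g\triangleright A\to Q$, $m\mapsto p(g^{-1}\triangleright m)$. An $A$-pattern $p$ semi-occurs in an $A'$-pattern $p'$ if there is $h\in H$ with $h\triangleright A\subseteq A'$ and $h\blacktriangleright p=p'|_{h\triangleright A}$. For a set $\mathfrak{F}$ of finite patterns, $\langle\mathfrak{F}\rangle$ is the set of $c\in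 Q^M$ in which no $\mathfrak{f}\in\mathfrak{F}$ semi-occurs. A subset $X\subseteq Q^M$ is a subshift of $Q^M$ if $X=\langle\mathfrak{F}\rangle$ for some set $\mathfrak{F}$ of finite patterns. A pattern is allowed in $X$ if it semi-occurs in some $x\in X$. For $X\subseteq Q^M$ and $A\subseteq M$, $X_A=\{x|_A: x\in X\}$. A subshift $X$ is $\kappa$-strongly irreducible ($\kappa\in\mathbb{N}_0$) if for all finite patterns $p,p'$ allowed in $X$ with $d(\mathrm{dom}(p),\mathrm{dom}(p'))\ge\kappa+1$ there is $x\in X$ with $x|_{\mathrm{dom}(p)}=p$ and $x|_{\mathrm{dom}(p')}=p'$. Amenability and entropy. $\mathcal{R}$ is right amenable if there is a finitely additive probability measure $\mu$ on all subsets of $M$ such that $\mu(A\triangleleft\mathfrak{g})=\mu(A)$ for all $\mathfrak{g}\in G/G_0$ and all $A\subseteq M$ on which $m\mapsto m\triangleleft\mathfrak{g}$ is injective; since $G_0$ is finite, this is equivalent to the existence of a right Følner net, i.e. a net $(F_i)_{i\in I}$ of non-empty finite subsets of $M$ with $\lim_{i\in I}|\partial_\rho F_i|/|F_i|=0$ for every $\rho\in\mathbb{N}_0$. For such a net $\mathcal{F}$ and $X\subseteq Q^M$, the entropy is $\mathrm{ent}_{\mathcal{F}}(X)=\limsup_{i\in I}\log|X_{F_i}|/|F_i|$ (with $\log 0=-\infty$). *)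

theory Defs
  imports
    "HOL-Analysis.Analysis"
    "HOL-Algebra.Left_Coset"
    "HOL-Algebra.Group_Action"
    "HOL-Library.Extended_Nat"
begin

section \<open>Cell spaces\<close>

record ('g, 'm) cell_data =
  sym_group :: "'g monoid"
  cells :: "'m set"
  act :: "'g \<Rightarrow> 'm \<Rightarrow> 'm"
  origin :: 'm
  coord :: "'m \<Rightarrow> 'g"

definition cell_space :: "('g, 'm) cell_data \<Rightarrow> bool" where
  "cell_space R \<longleftrightarrow>
     transitive_action (sym_group R) (cells R) (act R) \<and>
     origin R \<in> cells R \<and>
     (\<forall>m\<in>cells R. coord R m \<in> carrier (sym_group R) \<and> act R (coord R m) (origin R) = m)"

definition stab :: "('g, 'm) cell_data \<Rightarrow> 'g set" where
  "stab R = stabilizer (sym_group R) (act R) (origin R)"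

definition quot :: "('g, 'm) cell_data \<Rightarrow> 'g set set" where
  "quot R = lcosets\<^bsub>sym_group R\<^esub> (stab R)"

text \<open>The right semi-action is defined on cosets through an arbitrary representative; lemma
  \<open>semi_act_coset\<close> below shows that the choice does not matter.\<close>

definition semi_act :: "('g, 'm) cell_data \<Rightarrow> 'm \<Rightarrow> 'g set \<Rightarrow> 'm" where
  "semi_act R m C = act R (coord R m \<otimes>\<^bsub>sym_group R\<^esub> (SOME g. g \<in> C)) (origin R)"

lemma semi_act_coset:
  assumes R: "cell_space R" and m: "m \<in> cells R" and g: "g \<in> carrier (sym_group R)"
  shows "semi_act R m (g <#\<^bsub>sym_group R\<^esub> stab R)
           = act R (coord R m \<otimes>\<^bsub>sym_group R\<^esub> g) (origin R)"
proof -
  interpret transitive_action "sym_group R" "cells R" "act R"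
    using R by (simp add: cell_space_def)
  interpret group "sym_group R"
    using group_hom group_hom.axioms(1) by blast
  have o: "origin R \<in> cells R" and c: "coord R m \<in> carrier (sym_group R)"
    using R m by (auto simp: cell_space_def)
  have "\<one>\<^bsub>sym_group R\<^esub> \<in> stab R"
    using stabilizer_subgroup[OF o] by (simp add: stab_def subgroup.one_closed)
  then have ex: "\<exists>h. h \<in> g <#\<^bsub>sym_group R\<^esub> stab R"
    by (auto simp: l_coset_def)
  define h where "h = (SOME h. h \<in> g <#\<^bsub>sym_group R\<^esub> stab R)"
  have "h \<in> g <#\<^bsub>sym_group R\<^esub> stab R"
    unfolding h_def using ex by (rule someI_ex)
  then obtain k where k: "k \<in> stab R" "h = g \<otimes>\<^bsub>sym_group R\<^esub> k"
    by (auto simp: l_coset_def)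
  have k': "k \<in> carrier (sym_group R)" "act R k (origin R) = origin R"
    using k(1) by (auto simp: stab_def stabilizer_def)
  have "act R (coord R m \<otimes>\<^bsub>sym_group R\<^esub> h) (origin R)
      = act R ((coord R m \<otimes>\<^bsub>sym_group R\<^esub> g) \<otimes>\<^bsub>sym_group R\<^esub> k) (origin R)"
    using k k' c g by (simp add: m_assoc)
  also have "\<dots> = act R (coord R m \<otimes>\<^bsub>sym_group R\<^esub> g) (origin R)"
    using composition_rule[OF o, of "coord R m \<otimes>\<^bsub>sym_group R\<^esub> g" k] k' c g by simp
  finally show ?thesis by (simp add: semi_act_def h_def)
qed

definition symmetric_right_generating :: "('g, 'm) cell_data \<Rightarrow> 'g set set \<Rightarrow> bool" where
  "symmetric_right_generating R S \<longleftrightarrow>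
     S \<subseteq> quot R \<and>
     (\<forall>k\<in>stab R. \<forall>s\<in>S. k <#\<^bsub>sym_group R\<^esub> s \<in> S) \<and>
     (\<forall>s\<in>S. \<forall>g\<in>s. (inv\<^bsub>sym_group R\<^esub> g) <#\<^bsub>sym_group R\<^esub> stab R \<in> S) \<and>
     (\<forall>m\<in>cells R. \<exists>ss. set ss \<subseteq> S \<and> m = foldl (semi_act R) (origin R) ss)"

section \<open>Metric notions\<close>

definition cell_edges :: "('g, 'm) cell_data \<Rightarrow> 'g set set \<Rightarrow> ('m \<times> 'm) set" where
  "cell_edges R S = {(m, semi_act R m s) | m s. m \<in> cells R \<and> s \<in> S}"

text \<open>Length of a shortest path, \<open>\<infinity>\<close> if there is none. The edge relation need not be
  symmetrised, because it already is symmetric for a symmetric \<open>S\<close>.\<close>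

definition cell_dist :: "('g, 'm) cell_data \<Rightarrow> 'g set set \<Rightarrow> 'm \<Rightarrow> 'm \<Rightarrow> enat" where
  "cell_dist R S m m' = (INF n\<in>{n. (m, m') \<in> cell_edges R S ^^ n}. enat n)"

definition cell_ball :: "('g, 'm) cell_data \<Rightarrow> 'g set set \<Rightarrow> 'm \<Rightarrow> nat \<Rightarrow> 'm set" where
  "cell_ball R S m \<rho> = {m' \<in> cells R. cell_dist R S m m' \<le> enat \<rho>}"

definition set_dist :: "('g, 'm) cell_data \<Rightarrow> 'g set set \<Rightarrow> 'm set \<Rightarrow> 'm set \<Rightarrow> enat" where
  "set_dist R S A B = (INF a\<in>A. INF b\<in>B. cell_dist R S a b)"

definition inner_part :: "('g, 'm) cell_data \<Rightarrow> 'g set set \<Rightarrow> nat \<Rightarrow> 'm set \<Rightarrow> 'm set" where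
  "inner_part R S \<theta> A = {m \<in> A. cell_ball R S m \<theta> \<subseteq> A}"

definition outer_part :: "('g, 'm) cell_data \<Rightarrow> 'g set set \<Rightarrow> nat \<Rightarrow> 'm set \<Rightarrow> 'm set" where
  "outer_part R S \<theta> A = {m \<in> cells R. cell_ball R S m \<theta> \<inter> A \<noteq> {}}"

definition thick_boundary :: "('g, 'm) cell_data \<Rightarrow> 'g set set \<Rightarrow> nat \<Rightarrow> 'm set \<Rightarrow> 'm set" where
  "thick_boundary R S \<theta> A = outer_part R S \<theta> A - inner_part R S \<theta> A"

definition is_tiling ::
    "('g, 'm) cell_data \<Rightarrow> 'g set set \<Rightarrow> nat \<Rightarrow> nat \<Rightarrow> nat \<Rightarrow> 'm set \<Rightarrow> bool" where
  "is_tiling R S \<theta> \<kappa> \<theta>' T \<longleftrightarrow>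
     T \<subseteq> cells R \<and>
     (\<forall>t\<in>T. \<forall>t'\<in>T. t \<noteq> t' \<longrightarrow>
        enat (\<kappa> + 1) \<le> set_dist R S (cell_ball R S t \<theta>) (cell_ball R S t' \<theta>)) \<and>
     (\<Union>t\<in>T. cell_ball R S t \<theta>') = cells R"

section \<open>Patterns and subshifts\<close>

text \<open>An \<open>A\<close>-pattern is a partial map with domain exactly \<open>A\<close> and range in \<open>Q\<close>. Its restriction
  to \<open>B\<close> is \<^term>\<open>p |` B\<close>.\<close>

definition patterns :: "'q set \<Rightarrow> 'm set \<Rightarrow> ('m \<rightharpoonup> 'q) set" where
  "patterns Q A = {p. dom p = A \<and> ran p \<subseteq> Q}"

definition finite_patterns :: "('g, 'm) cell_data \<Rightarrow> 'q set \<Rightarrow> ('m \<rightharpoonup> 'q) set" where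
  "finite_patterns R Q = (\<Union>A\<in>{A. A \<subseteq> cells R \<and> finite A}. patterns Q A)"

definition act_pattern :: "('g, 'm) cell_data \<Rightarrow> 'g \<Rightarrow> ('m \<rightharpoonup> 'q) \<Rightarrow> ('m \<rightharpoonup> 'q)" where
  "act_pattern R g p = (\<lambda>m. p (act R (inv\<^bsub>sym_group R\<^esub> g) m)) |` (act R g ` dom p)"

definition semi_occurs ::
    "('g, 'm) cell_data \<Rightarrow> 'g set \<Rightarrow> ('m \<rightharpoonup> 'q) \<Rightarrow> ('m \<rightharpoonup> 'q) \<Rightarrow> bool" where
  "semi_occurs R H p p' \<longleftrightarrow>
     (\<exists>h\<in>H. act R h ` dom p \<subseteq> dom p' \<and> act_pattern R h p = p' |` (act R h ` dom p))"

definition shift_avoiding ::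
    "('g, 'm) cell_data \<Rightarrow> 'g set \<Rightarrow> 'q set \<Rightarrow> ('m \<rightharpoonup> 'q) set \<Rightarrow> ('m \<rightharpoonup> 'q) set" where
  "shift_avoiding R H Q \<FF> = {c \<in> patterns Q (cells R). \<forall>f\<in>\<FF>. \<not> semi_occurs R H f c}"

definition subshift ::
    "('g, 'm) cell_data \<Rightarrow> 'g set \<Rightarrow> 'q set \<Rightarrow> ('m \<rightharpoonup> 'q) set \<Rightarrow> bool" where
  "subshift R H Q X \<longleftrightarrow> (\<exists>\<FF>. \<FF> \<subseteq> finite_patterns R Q \<and> X = shift_avoiding R H Q \<FF>)"

definition allowed ::
    "('g, 'm) cell_data \<Rightarrow> 'g set \<Rightarrow> ('m \<rightharpoonup> 'q) set \<Rightarrow> ('m \<rightharpoonup> 'q) \<Rightarrow> bool" where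
  "allowed R H X p \<longleftrightarrow> (\<exists>x\<in>X. semi_occurs R H p x)"

definition restrictions :: "('m \<rightharpoonup> 'q) set \<Rightarrow> 'm set \<Rightarrow> ('m \<rightharpoonup> 'q) set" where
  "restrictions X A = (\<lambda>x. x |` A) ` X"

definition strongly_irreducible ::
    "('g, 'm) cell_data \<Rightarrow> 'g set set \<Rightarrow> 'g set \<Rightarrow> 'q set \<Rightarrow> nat \<Rightarrow> ('m \<rightharpoonup> 'q) set \<Rightarrow> bool" where
  "strongly_irreducible R S H Q \<kappa> X \<longleftrightarrow>
     (\<forall>p\<in>finite_patterns R Q. \<forall>p'\<in>finite_patterns R Q.
        allowed R H X p \<and> allowed R H X p' \<and> enat (\<kappa> + 1) \<le> set_dist R S (dom p) (dom p') \<longrightarrow>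
        (\<exists>x\<in>X. x |` dom p = p \<and> x |` dom p' = p'))"

section \<open>Amenability and entropy\<close>

definition right_amenable :: "('g, 'm) cell_data \<Rightarrow> bool" where
  "right_amenable R \<longleftrightarrow>
     (\<exists>\<mu> :: 'm set \<Rightarrow> real.
        (\<forall>A\<subseteq>cells R. 0 \<le> \<mu> A) \<and>
        \<mu> (cells R) = 1 \<and>
        Measure_Space.additive (Pow (cells R)) \<mu> \<and>
        (\<forall>C\<in>quot R. \<forall>A\<subseteq>cells R. inj_on (\<lambda>m. semi_act R m C) A \<longrightarrow>
           \<mu> ((\<lambda>m. semi_act R m C) ` A) = \<mu> A))"

definition directed_preorder :: "'i set \<Rightarrow> ('i \<times> 'i) set \<Rightarrow> bool" where
  "directed_preorder I r \<longleftrightarrow>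
     I \<noteq> {} \<and> preorder_on I r \<and> (\<forall>i\<in>I. \<forall>j\<in>I. \<exists>k\<in>I. (i, k) \<in> r \<and> (j, k) \<in> r)"

text \<open>Limits along a net are limits along the filter generated by the tails of its index set.\<close>

definition tail_filter :: "'i set \<Rightarrow> ('i \<times> 'i) set \<Rightarrow> 'i filter" where
  "tail_filter I r = (INF i\<in>I. principal {j \<in> I. (i, j) \<in> r})"

lemma eventually_tail_filter:
  assumes "directed_preorder I r"
  shows "eventually P (tail_filter I r) \<longleftrightarrow> (\<exists>i\<in>I. \<forall>j\<in>I. (i, j) \<in> r \<longrightarrow> P j)"
proof -
  have tr: "trans r"
    using assms by (auto simp: directed_preorder_def preorder_on_def)
  have "eventually P (INF i\<in>I. principal {j \<in> I. (i, j) \<in> r})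
      \<longleftrightarrow> (\<exists>i\<in>I. eventually P (principal {j \<in> I. (i, j) \<in> r}))"
  proof (rule eventually_INF_base)
    show "I \<noteq> {}" using assms by (simp add: directed_preorder_def)
  next
    fix i j assume "i \<in> I" "j \<in> I"
    then obtain k where k: "k \<in> I" "(i, k) \<in> r" "(j, k) \<in> r"
      using assms unfolding directed_preorder_def by blast
    have "{l \<in> I. (k, l) \<in> r} \<subseteq> {l \<in> I. (i, l) \<in> r} \<inter> {l \<in> I. (j, l) \<in> r}"
      using k transD[OF tr] by blast
    then show "\<exists>x\<in>I. principal {l \<in> I. (x, l) \<in> r}
        \<le> inf (principal {l \<in> I. (i, l) \<in> r}) (principal {l \<in> I. (j, l) \<in> r})"
      using k(1) by auto
  qed
  then show ?thesis by (auto simp: tail_filter_def eventually_principal)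
qed

definition right_folner_net ::
    "('g, 'm) cell_data \<Rightarrow> 'g set set \<Rightarrow> 'i set \<Rightarrow> ('i \<times> 'i) set \<Rightarrow> ('i \<Rightarrow> 'm set) \<Rightarrow> bool" where
  "right_folner_net R S I r F \<longleftrightarrow>
     directed_preorder I r \<and>
     (\<forall>i\<in>I. F i \<noteq> {} \<and> finite (F i) \<and> F i \<subseteq> cells R) \<and>
     (\<forall>\<rho>. ((\<lambda>i. real (card (thick_boundary R S \<rho> (F i))) / real (card (F i))) \<longlongrightarrow> 0)
        (tail_filter I r))"

text \<open>The explicit case is needed since \<^term>\<open>ln (0::real)\<close> is \<open>0\<close> in HOL.\<close>

definition ln_card :: "'a set \<Rightarrow> ereal" where
  "ln_card A = (if card A = 0 then -\<infinity> else ereal (ln (real (card A))))"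

definition entropy ::
    "'i set \<Rightarrow> ('i \<times> 'i) set \<Rightarrow> ('i \<Rightarrow> 'm set) \<Rightarrow> ('m \<rightharpoonup> 'q) set \<Rightarrow> ereal" where
  "entropy I r F X =
     Limsup (tail_filter I r) (\<lambda>i. ln_card (restrictions X (F i)) / ereal (real (card (F i))))"

end

theory Submission
  imports Defs
begin

text \<open>
  Let \<open>U\<close> be the set of tiles \<open>t\<close> with \<open>B(t, \<theta>) \<subseteq> F\<close>, and pick for each of them a pattern
  \<open>p t\<close> of \<open>X\<close> on \<open>B(t, \<theta>)\<close> that no element of \<open>Y\<close> shows. Forbidding one more \<open>p t\<close> shrinks
  the set of patterns on \<open>F\<close> by a factor that does not depend on \<open>t\<close> or \<open>F\<close>: by strong
  irreducibility \<open>p t\<close> can be planted into any pattern by changing only cells at distance at most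
  \<open>\<kappa>\<close> from \<open>B(t, \<theta>)\<close>, which leaves the other tiles intact, and boundedly many patterns agree
  outside this neighbourhood. Hence \<open>|Y_F| \<le> c ^ |U| |X_F|\<close> with \<open>c < 1\<close>. Along a Folner net
  \<open>|U| \<ge> \<delta> |F|\<close> eventually, so the entropy drops by at least \<open>- \<delta> ln c\<close>.
\<close>

section \<open>The cell graph\<close>

text \<open>For a representative \<open>g\<close> of \<open>s\<close>, the coset of
  \<open>inv g\<close> need not lead back to \<open>m\<close>: \<open>coord R m'\<close> agrees with
  the product of \<open>coord R m\<close> and \<open>g\<close> only up to the stabiliser. The
  closure of \<open>S\<close> under inverses covers every representative of \<open>s\<close>, so one
  that hits \<open>coord R m'\<close> exactly can be chosen.\<close>

lemma cell_edges_sym: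
  assumes R: "cell_space R" and S: "symmetric_right_generating R S"
    and e: "(m, m') \<in> cell_edges R S"
  shows "(m', m) \<in> cell_edges R S"
proof -
  interpret transitive_action "sym_group R" "cells R" "act R"
    using R by (simp add: cell_space_def)
  interpret group "sym_group R"
    using group_hom group_hom.axioms(1) by blast
  let ?G = "sym_group R"
  have o: "origin R \<in> cells R"
    using R by (simp add: cell_space_def)
  obtain s where m: "m \<in> cells R" and s: "s \<in> S" and m': "m' = semi_act R m s"
    using e by (auto simp: cell_edges_def)
  obtain g where g: "g \<in> carrier ?G" and sg: "s = g <#\<^bsub>?G\<^esub> stab R"
    using s S by (auto simp: symmetric_right_generating_def quot_def LCOSETS_def)
  have c: "coord R m \<in> carrier ?G" "act R (coord R m) (origin R) = m"
    using R m by (auto simp: cell_space_def)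
  have m'_eq: "m' = act R (coord R m \<otimes>\<^bsub>?G\<^esub> g) (origin R)"
    using semi_act_coset[OF R m g] sg m' by simp
  then have m'_in: "m' \<in> cells R"
    using c g o element_image by blast
  have c': "coord R m' \<in> carrier ?G" "act R (coord R m') (origin R) = m'"
    using R m'_in by (auto simp: cell_space_def)
  \<comment> \<open>This is that representative: multiplying \<open>coord R m\<close> by
    \<open>g\<close> or by \<open>h\<close> gives two elements that send the origin to
    \<open>m'\<close>, so \<open>g\<close> and \<open>h\<close> differ by an element of the
    stabiliser.\<close>
  define h where "h = inv\<^bsub>?G\<^esub> (coord R m) \<otimes>\<^bsub>?G\<^esub> coord R m'"
  have h: "h \<in> carrier ?G" and c'h: "coord R m \<otimes>\<^bsub>?G\<^esub> h = coord R m'"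
    using c c' by (auto simp: h_def m_assoc[symmetric])
  have c'_h: "coord R m' \<otimes>\<^bsub>?G\<^esub> inv\<^bsub>?G\<^esub> h = coord R m"
    unfolding c'h[symmetric] using c(1) h by (simp add: m_assoc)
  have "act R (inv\<^bsub>?G\<^esub> g \<otimes>\<^bsub>?G\<^esub> h) (origin R)
      = act R (inv\<^bsub>?G\<^esub> (coord R m \<otimes>\<^bsub>?G\<^esub> g)) (act R (coord R m \<otimes>\<^bsub>?G\<^esub> h) (origin R))"
    using composition_rule[OF o, of "inv\<^bsub>?G\<^esub> (coord R m \<otimes>\<^bsub>?G\<^esub> g)" "coord R m \<otimes>\<^bsub>?G\<^esub> h"] c g h
    by (simp add: inv_mult_group m_assoc) (simp add: m_assoc[symmetric])
  also have "\<dots> = origin R"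
    using c'(2) c'h m'_eq orbit_sym_aux[OF _ o, of "coord R m \<otimes>\<^bsub>?G\<^esub> g" m'] c g by simp
  finally have "inv\<^bsub>?G\<^esub> g \<otimes>\<^bsub>?G\<^esub> h \<in> stab R"
    using g h by (simp add: stab_def stabilizer_def)
  moreover have "h = g \<otimes>\<^bsub>?G\<^esub> (inv\<^bsub>?G\<^esub> g \<otimes>\<^bsub>?G\<^esub> h)"
    using g h by (simp add: m_assoc[symmetric])
  ultimately have "h \<in> s"
    unfolding sg l_coset_def by blast
  then have "inv\<^bsub>?G\<^esub> h <#\<^bsub>?G\<^esub> stab R \<in> S"
    using S s by (simp add: symmetric_right_generating_def)
  moreover have "semi_act R m' (inv\<^bsub>?G\<^esub> h <#\<^bsub>?G\<^esub> stab R) = m"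
    using semi_act_coset[OF R m'_in, of "inv\<^bsub>?G\<^esub> h"] h c'_h c(2) by simp
  ultimately show ?thesis
    using m'_in unfolding cell_edges_def by force
qed

section \<open>Paths, balls and distances\<close>

lemma cell_dist_le_iff:
  "cell_dist R S m m' \<le> enat n \<longleftrightarrow> (\<exists>k\<le>n. (m, m') \<in> cell_edges R S ^^ k)"
proof
  let ?K = "{k. (m, m') \<in> cell_edges R S ^^ k}"
  assume le: "cell_dist R S m m' \<le> enat n"
  \<comment> \<open>The infimum over the empty set is \<infinity>, so a finite bound yields some
    path; the infimum of a non-empty set in \<open>enat\<close> is attained.\<close>
  then have "enat ` ?K \<noteq> {}"
    unfolding cell_dist_def by (metis Inf_empty enat_ord_simps(5) infinity_ileE top_enat_def)
  then have "Inf (enat ` ?K) \<in> enat ` ?K"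
    by (metis Inf_enat_def LeastI_ex ex_in_conv)
  then show "\<exists>k\<le>n. (m, m') \<in> cell_edges R S ^^ k"
    using le by (auto simp: cell_dist_def)
next
  assume "\<exists>k\<le>n. (m, m') \<in> cell_edges R S ^^ k"
  then show "cell_dist R S m m' \<le> enat n"
    by (auto simp: cell_dist_def intro!: INF_lower2)
qed

lemma cell_ball_iff:
  "m' \<in> cell_ball R S m n \<longleftrightarrow> m' \<in> cells R \<and> (\<exists>k\<le>n. (m, m') \<in> cell_edges R S ^^ k)"
  by (simp add: cell_ball_def cell_dist_le_iff)

lemma cell_ball_self: "m \<in> cells R \<Longrightarrow> m \<in> cell_ball R S m n"
  by (auto simp: cell_ball_iff intro: exI[of _ 0])

lemma cell_ball_trans:
  assumes "b \<in> cell_ball R S a j" "c \<in> cell_ball R S b k"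
  shows "c \<in> cell_ball R S a (j + k)"
  using assms unfolding cell_ball_iff by (meson add_mono relpow_trans)

lemma cell_path_sym:
  assumes "cell_space R" "symmetric_right_generating R S" "(a, b) \<in> cell_edges R S ^^ k"
  shows "(b, a) \<in> cell_edges R S ^^ k"
  using assms(3)
proof (induction k arbitrary: b)
  case (Suc k)
  then obtain z where z: "(a, z) \<in> cell_edges R S ^^ k" "(z, b) \<in> cell_edges R S"
    by (elim relpow_Suc_E)
  show ?case
    using cell_edges_sym[OF assms(1,2) z(2)] Suc.IH[OF z(1)] by (rule relpow_Suc_I2)
qed simp

lemma cell_ball_sym:
  assumes "cell_space R" "symmetric_right_generating R S" "a \<in> cells R"
    and "b \<in> cell_ball R S a n"
  shows "a \<in> cell_ball R S b n"
proof -
  obtain k where "k \<le> n" "(a, b) \<in> cell_edges R S ^^ k"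
    using assms(4) by (auto simp: cell_ball_iff)
  then show ?thesis
    using cell_path_sym[OF assms(1,2)] assms(3) unfolding cell_ball_iff by metis
qed

text \<open>Each edge leaving a cell comes from an element of \<open>S\<close>, so each step
  multiplies the number of endpoints by at most \<open>card S\<close>. The bound does not depend on
  \<open>m\<close>, which makes the later constants uniform over all tiles.\<close>

lemma cell_sphere_card_le:
  assumes "finite S"
  shows "finite ((cell_edges R S ^^ k) `` {m})" "card ((cell_edges R S ^^ k) `` {m}) \<le> card S ^ k"
proof (induction k)
  case (Suc k)
  let ?E = "cell_edges R S" and ?A = "(cell_edges R S ^^ k) `` {m}"
  have sub: "?E `` {x} \<subseteq> semi_act R x ` S" for x
    by (auto simp: cell_edges_def)
  have fin: "finite (?E `` {x})" and card: "card (?E `` {x}) \<le> card S" for x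
    using sub[of x] assms by (auto intro: finite_subset surj_card_le)
  have eq: "(?E ^^ Suc k) `` {m} = (\<Union>x\<in>?A. ?E `` {x})"
    by auto
  { case 1 show ?case using Suc fin by (simp only: eq) blast }
  { case 2
    have "card (\<Union>x\<in>?A. ?E `` {x}) \<le> (\<Sum>x\<in>?A. card (?E `` {x}))"
      using Suc by (intro card_UN_le)
    also have "\<dots> \<le> card ?A * card S"
      using sum_bounded_above[of ?A "\<lambda>x. card (?E `` {x})", OF card] by (simp only: of_nat_id)
    also have "\<dots> \<le> card S ^ Suc k"
      using Suc by (simp add: mult.commute)
    finally show ?case by (simp only: eq) }
qed (simp_all add: Image_def)

lemma finite_cell_ball:
  assumes "finite S" shows "finite (cell_ball R S m n)"
proof (rule finite_subset)
  show "cell_ball R S m n \<subseteq> (\<Union>k\<le>n. (cell_edges R S ^^ k) `` {m})"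
    by (auto simp: cell_ball_iff)
qed (simp add: cell_sphere_card_le(1)[OF assms])

lemma card_cell_ball_le:
  assumes "finite S" shows "card (cell_ball R S m n) \<le> (\<Sum>k\<le>n. card S ^ k)"
proof -
  have "card (cell_ball R S m n) \<le> card (\<Union>k\<le>n. (cell_edges R S ^^ k) `` {m})"
    using cell_sphere_card_le(1)[OF assms] by (intro card_mono) (auto simp: cell_ball_iff)
  also have "\<dots> \<le> (\<Sum>k\<le>n. card ((cell_edges R S ^^ k) `` {m}))"
    by (intro card_UN_le) simp
  also have "\<dots> \<le> (\<Sum>k\<le>n. card S ^ k)"
    using cell_sphere_card_le(2)[OF assms] by (intro sum_mono)
  finally show ?thesis .
qed

lemma set_dist_geI:
  assumes "\<And>a b. a \<in> A \<Longrightarrow> b \<in> B \<Longrightarrow> b \<in> cells R \<and> b \<notin> cell_ball R S a k"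
  shows "enat (k + 1) \<le> set_dist R S A B"
  unfolding set_dist_def
proof (intro INF_greatest)
  fix a b assume "a \<in> A" "b \<in> B"
  \<comment> \<open>Balls contain only cells, so \<open>b\<close> must be known to be a cell before
    its absence from the ball says anything about distance.\<close>
  then have "enat k < cell_dist R S a b"
    using assms[of a b] by (auto simp: cell_ball_def)
  then show "enat (k + 1) \<le> cell_dist R S a b"
    by (metis Suc_eq_plus1 Suc_ile_eq)
qed

lemma set_dist_geD:
  assumes "enat (k + 1) \<le> set_dist R S A B" "a \<in> A" "b \<in> B"
  shows "b \<notin> cell_ball R S a k"
proof -
  have "set_dist R S A B \<le> cell_dist R S a b"
    unfolding set_dist_def using assms(2,3) by (meson INF_lower INF_lower2)
  then have "enat (k + 1) \<le> cell_dist R S a b"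
    using assms(1) by (rule order_trans[rotated])
  then have "enat k < cell_dist R S a b"
    by (simp add: Suc_ile_eq)
  then show ?thesis by (auto simp: cell_ball_def)
qed

section \<open>Patterns\<close>

lemma restrict_map_in_patterns:
  assumes "x \<in> patterns Q A" "B \<subseteq> A" shows "x |` B \<in> patterns Q B"
  using assms by (auto simp: patterns_def ran_def restrict_map_def split: if_splits)

lemma card_patterns_le:
  assumes "finite A" "finite Q"
  shows "finite (patterns Q A)" "card (patterns Q A) \<le> card Q ^ card A"
proof -
  \<comment> \<open>Partial maps with domain \<open>A\<close> embed into the extensional functions
    from \<open>A\<close> to \<open>Q\<close>, whose number is known.\<close>
  let ?f = "\<lambda>p. restrict (\<lambda>m. the (p m)) A"
  have inj: "inj_on ?f (patterns Q A)"
  proof (rule inj_onI, rule ext)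
    fix p p' m assume "p \<in> patterns Q A" "p' \<in> patterns Q A" and eq: "?f p = ?f p'"
    then have d: "dom p = A" "dom p' = A" by (auto simp: patterns_def)
    show "p m = p' m"
      using fun_cong[OF eq, of m] d
      by (cases "m \<in> A"; cases "p m"; cases "p' m") (auto simp: domIff)
  qed
  have sub: "?f ` patterns Q A \<subseteq> A \<rightarrow>\<^sub>E Q"
    by (auto simp: patterns_def ran_def domIff subset_eq)
  have fin: "finite (A \<rightarrow>\<^sub>E Q)" using assms by (simp add: finite_PiE)
  show "finite (patterns Q A)"
    using fin inj sub by (metis inj_on_finite)
  show "card (patterns Q A) \<le> card Q ^ card A"
    using card_inj_on_le[OF inj sub fin] assms by (simp add: card_PiE)
qed

lemma restrictions_subset_patterns:
  assumes "X \<subseteq> patterns Q A" "B \<subseteq> A" shows "restrictions X B \<subseteq> patterns Q B"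
  using assms unfolding restrictions_def by (blast intro: restrict_map_in_patterns)

lemma finite_restrictions:
  assumes "X \<subseteq> patterns Q A" "B \<subseteq> A" "finite B" "finite Q" shows "finite (restrictions X B)"
  by (rule finite_subset[OF restrictions_subset_patterns[OF assms(1,2)]
        card_patterns_le(1)[OF assms(3,4)]])

text \<open>An element of \<open>A\<close> can be recovered from its partner in \<open>G\<close>,
  which fixes its values on \<open>F - N\<close>, together with its own values on
  \<open>F \<inter> N\<close>; the latter leave boundedly many choices.\<close>

lemma card_le_card_overwrite:
  assumes "finite F" "finite Q" "A \<subseteq> patterns Q F" "G \<subseteq> patterns Q F" "finite N" "card N \<le> n"
    and ex: "\<And>a. a \<in> A \<Longrightarrow> \<exists>b\<in>G. b |` (F - N) = a |` (F - N)"
  shows "card A \<le> card G * Suc (card Q) ^ n"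
proof -
  obtain b where b: "\<And>a. a \<in> A \<Longrightarrow> b a \<in> G \<and> b a |` (F - N) = a |` (F - N)"
    using ex by metis
  let ?f = "\<lambda>a. (b a, a |` (F \<inter> N))"
  have finG: "finite G"
    using assms card_patterns_le(1) finite_subset by metis
  have finP: "finite (patterns Q (F \<inter> N))"
    using assms by (intro card_patterns_le) auto
  have inj: "inj_on ?f A"
  proof (rule inj_onI, rule ext)
    fix a a' m assume a: "a \<in> A" "a' \<in> A" and eq: "?f a = ?f a'"
    then have 1: "a |` (F - N) = a' |` (F - N)" and 2: "a |` (F \<inter> N) = a' |` (F \<inter> N)"
      using b by (metis prod.inject)+
    have d: "dom a = F" "dom a' = F" using a assms(3) by (auto simp: patterns_def)
    show "a m = a' m"
      using fun_cong[OF 1, of m] fun_cong[OF 2, of m] d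
      by (cases "m \<in> F"; cases "m \<in> N") (auto simp: domIff)
  qed
  have sub: "?f ` A \<subseteq> G \<times> patterns Q (F \<inter> N)"
    using b assms(3) by (auto intro!: restrict_map_in_patterns[of _ Q F])
  have "card A \<le> card (G \<times> patterns Q (F \<inter> N))"
    using inj sub finG finP by (intro card_inj_on_le) auto
  also have "\<dots> \<le> card G * card Q ^ card (F \<inter> N)"
    using assms card_patterns_le(2)[of "F \<inter> N" Q] by (simp add: card_cartesian_product)
  \<comment> \<open>A base of at least 1 allows the exponent to be raised to \<open>n\<close>, also
    when \<open>Q\<close> is empty.\<close>
  also have "card Q ^ card (F \<inter> N) \<le> Suc (card Q) ^ card (F \<inter> N)"
    by (intro power_mono) auto
  also have "Suc (card Q) ^ card (F \<inter> N) \<le> Suc (card Q) ^ n"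
    using assms(5,6) card_mono[of N "F \<inter> N"] by (intro power_increasing) auto
  finally show ?thesis by simp
qed

text \<open>The neutral element lies in the subgroup \<open>H\<close> and fixes every cell, so it
  witnesses the semi-occurrence of the restriction in \<open>x\<close>.\<close>

lemma restriction_allowed:
  assumes R: "cell_space R" and H: "subgroup H (sym_group R)"
    and X: "X \<subseteq> patterns Q (cells R)" and x: "x \<in> X" and A: "A \<subseteq> cells R"
  shows "allowed R H X (x |` A)"
proof -
  interpret transitive_action "sym_group R" "cells R" "act R"
    using R by (simp add: cell_space_def)
  interpret group "sym_group R"
    using group_hom group_hom.axioms(1) by blast
  let ?one = "\<one>\<^bsub>sym_group R\<^esub>"
  have domx: "dom x = cells R"
    using X x by (auto simp: patterns_def)
  then have dom: "dom (x |` A) = A"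
    using A by auto
  have act: "act R ?one m = m" if "m \<in> A" for m
    using that A id_eq_one by (metis restrict_apply subsetD)
  have img: "act R ?one ` A = A" using act by auto
  have "act_pattern R ?one (x |` A) = x |` A"
    unfolding act_pattern_def dom img by (rule ext) (auto simp: restrict_map_def act)
  then have "semi_occurs R H (x |` A) x"
    using subgroup.one_closed[OF H] A domx unfolding semi_occurs_def dom by (metis dom img)
  then show ?thesis using x by (auto simp: allowed_def)
qed

text \<open>\<^term>\<open>Suc (card Q)\<close> and the \<open>+ 1\<close> keep the factor strictly between 0 and 1 even for
  \<^term>\<open>card Q \<le> 1\<close> or \<open>n = 0\<close>.\<close>

lemma card_restrictions_avoiding_le:
  fixes R :: "('g, 'm) cell_data" and D :: "'t \<Rightarrow> 'm set" and p :: "'t \<Rightarrow> 'm \<rightharpoonup> 'q"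
  assumes R: "cell_space R" and S: "finite S" and H: "subgroup H (sym_group R)"
    and Q: "finite Q" and X: "X \<subseteq> patterns Q (cells R)"
    and irr: "strongly_irreducible R S H Q \<kappa> X"
    and F: "finite F" "F \<subseteq> cells R"
    and U: "finite U" "\<And>t. t \<in> U \<Longrightarrow> D t \<subseteq> F"
    and n: "\<And>t. t \<in> U \<Longrightarrow> card (\<Union>a\<in>D t. cell_ball R S a \<kappa>) \<le> n"
    and far: "\<And>t t'. t \<in> U \<Longrightarrow> t' \<in> U \<Longrightarrow> t \<noteq> t' \<Longrightarrow> enat (\<kappa> + 1) \<le> set_dist R S (D t) (D t')"
    and p: "\<And>t. t \<in> U \<Longrightarrow> p t \<in> restrictions X (D t)"
  shows "real (card (restrictions {x \<in> X. \<forall>t\<in>U. x |` D t \<noteq> p t} F))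
    \<le> (1 - 1 / (real (Suc (card Q)) ^ n + 1)) ^ card U * real (card (restrictions X F))"
  using U n far p
proof (induction U rule: finite_induct)
  case (insert t U)
  define L where "L = Suc (card Q) ^ n"
  define c where "c = 1 - 1 / (real L + 1)"
  \<comment> \<open>\<open>A\<close> is what the tiles in \<open>U\<close> leave over, and
    \<open>G\<close> is the portion that forbidding \<open>p t\<close> removes. It remains to show
    that \<open>G\<close> is a fixed fraction of \<open>A\<close>.\<close>
  define A where "A = restrictions {x \<in> X. \<forall>t\<in>U. x |` D t \<noteq> p t} F"
  define G where "G = {a \<in> A. a |` D t = p t}"
  define N where "N = (\<Union>a\<in>D t. cell_ball R S a \<kappa>)"
  let ?B = "restrictions {x \<in> X. \<forall>t\<in>insert t U. x |` D t \<noteq> p t} F"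
  have DF: "D t' \<subseteq> F" if "t' \<in> insert t U" for t' using insert.prems(1) that by blast
  have finN: "finite N"
    unfolding N_def using F(1) DF[of t] S by (auto intro: finite_subset finite_cell_ball)
  have AP: "A \<subseteq> patterns Q F"
    unfolding A_def using X by (intro restrictions_subset_patterns[OF _ F(2)]) blast
  then have finA: "finite A" using F(1) Q card_patterns_le(1) finite_subset by metis
  \<comment> \<open>As each tile lies in \<open>F\<close>, whether \<open>x\<close> shows
    \<open>p t'\<close> can be read off from its restriction to \<open>F\<close>.\<close>
  have res: "(x |` F) |` D t' = x |` D t'" if "t' \<in> insert t U" for x :: "'m \<rightharpoonup> 'q" and t'
    using DF[OF that] by (simp add: Int_absorb1)
  have BAG: "?B \<subseteq> A - G"
  proof
    fix a assume "a \<in> ?B"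
    then obtain x where "x \<in> X" "\<forall>t\<in>insert t U. x |` D t \<noteq> p t" "a = x |` F"
      by (auto simp: restrictions_def)
    then show "a \<in> A - G"
      using res[of t x] by (auto simp: A_def G_def restrictions_def simp del: restrict_restrict)
  qed
  have "card A \<le> card G * Suc (card Q) ^ n"
  proof (rule card_le_card_overwrite[OF F(1) Q AP _ finN])
    show "G \<subseteq> patterns Q F" using AP by (auto simp: G_def)
    show "card N \<le> n" using insert.prems(2) by (simp add: N_def)
    fix a assume "a \<in> A"
    then obtain x where x: "x \<in> X" "\<And>t. t \<in> U \<Longrightarrow> x |` D t \<noteq> p t" "a = x |` F"
      by (auto simp: A_def restrictions_def)
    \<comment> \<open>The pattern of \<open>z\<close> on the tile and that of \<open>x\<close> on
      \<open>F - N\<close> are to be glued by strong irreducibility; removing the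
      \<open>\<kappa>\<close>-neighbourhood \<open>N\<close> of the tile provides the required
      gap.\<close>
    obtain z where z: "z \<in> X" "p t = z |` D t"
      using insert.prems(4) by (auto simp: restrictions_def)
    have DC: "D t \<subseteq> cells R" "finite (D t)" and FC: "F - N \<subseteq> cells R" "finite (F - N)"
      using DF[of t] F by (auto intro: finite_subset)
    have pat: "z |` D t \<in> patterns Q (D t)" "x |` (F - N) \<in> patterns Q (F - N)"
      using X x z DC FC by (auto intro: restrict_map_in_patterns)
    then have dom: "dom (z |` D t) = D t" "dom (x |` (F - N)) = F - N"
      by (simp_all add: patterns_def)
    have "z |` D t \<in> finite_patterns R Q" "x |` (F - N) \<in> finite_patterns R Q"
      unfolding finite_patterns_def using pat DC FC by blast+
    moreover have "allowed R H X (z |` D t)" "allowed R H X (x |` (F - N))"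
      using restriction_allowed[OF R H X] x z DC FC by auto
    moreover have "enat (\<kappa> + 1) \<le> set_dist R S (D t) (F - N)"
      using FC by (intro set_dist_geI) (auto simp: N_def)
    ultimately obtain y where y: "y \<in> X" "y |` D t = z |` D t" "y |` (F - N) = x |` (F - N)"
      using irr dom unfolding strongly_irreducible_def by metis
    \<comment> \<open>Another tile is more than \<open>\<kappa>\<close> away from
      \<open>D t\<close>, so it misses \<open>N\<close>; there \<open>y\<close> equals
      \<open>x\<close> and still avoids the forbidden pattern.\<close>
    have "y |` D t' \<noteq> p t'" if t': "t' \<in> U" for t'
    proof -
      have "t \<noteq> t'" using t' insert.hyps by auto
      then have "D t' \<inter> N = {}"
        using set_dist_geD[OF insert.prems(3)[of t t']] t' by (auto simp: N_def)
      then have "D t' \<subseteq> F - N" using DF[of t'] t' by auto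
      then have "y |` D t' = x |` D t'"
        using arg_cong[OF y(3), of "\<lambda>z. z |` D t'"] by (simp add: Int_absorb1)
      then show ?thesis using x(2)[OF t'] by simp
    qed
    then have "y |` F \<in> G"
      using y z res[of t y] by (auto simp: G_def A_def restrictions_def)
    moreover have "(y |` F) |` (F - N) = a |` (F - N)"
      using y(3) x(3) by (simp add: Int_absorb1)
    ultimately show "\<exists>b\<in>G. b |` (F - N) = a |` (F - N)" by blast
  qed
  then have "real (card A) \<le> real (card G) * real L"
    unfolding L_def by (metis of_nat_le_iff of_nat_mult)
  \<comment> \<open>Thus \<open>G\<close> has at least the fraction \<open>1 / (L + 1)\<close> of
    the elements of \<open>A\<close>.\<close>
  then have le: "real (card A) \<le> real (card G) * (real L + 1)"
    by (simp add: algebra_simps)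
  have "card ?B \<le> card (A - G)" using BAG finA by (intro card_mono) auto
  also have "\<dots> = card A - card G"
    using finA by (intro card_Diff_subset) (auto simp: G_def)
  \<comment> \<open>Since \<open>G\<close> is contained in \<open>A\<close>, the subtraction of
    natural numbers is not truncated.\<close>
  finally have "real (card ?B) \<le> real (card A) - real (card G)"
    using card_mono[OF finA, of G] by (auto simp: G_def)
  also have "\<dots> \<le> c * real (card A)"
    using le by (simp add: c_def field_simps)
  also have "\<dots> \<le> c * (c ^ card U * real (card (restrictions X F)))"
    using insert.IH insert.prems unfolding A_def c_def L_def
    by (intro mult_left_mono) (auto simp: divide_le_eq_1 add_pos_pos)
  also have "\<dots> = c ^ card (insert t U) * real (card (restrictions X F))"
    using insert.hyps by simp
  finally show ?case
    by (simp only: c_def L_def of_nat_power)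
qed simp

section \<open>Density of the tiling\<close>

text \<open>A cell of \<open>F\<close> off the boundary has its whole ball of radius
  \<open>\<theta> + \<theta>'\<close> in \<open>F\<close>. A tile centre within
  \<open>\<theta>'\<close> of it therefore has its \<open>\<theta>\<close>-ball in \<open>F\<close>,
  so the \<open>\<theta>'\<close>-balls of such tiles cover everything off the boundary.\<close>

lemma card_minus_boundary_le_tiles:
  assumes R: "cell_space R" and S: "finite S" "symmetric_right_generating R S"
    and T: "T \<subseteq> cells R" "(\<Union>t\<in>T. cell_ball R S t \<theta>') = cells R"
    and F: "finite F" "F \<subseteq> cells R"
  shows "card F \<le> card {t \<in> T. cell_ball R S t \<theta> \<subseteq> F} * (\<Sum>k\<le>\<theta>'. card S ^ k)
           + card (thick_boundary R S (\<theta> + \<theta>') F)"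
proof -
  let ?U = "{t \<in> T. cell_ball R S t \<theta> \<subseteq> F}" and ?bd = "thick_boundary R S (\<theta> + \<theta>') F"
  \<comment> \<open>Each centre belongs to its own ball, hence to \<open>F\<close>.\<close>
  have finU: "finite ?U"
    using T(1) cell_ball_self[of _ R S \<theta>] by (intro finite_subset[OF _ F(1)]) blast
  have "F - ?bd \<subseteq> (\<Union>t\<in>?U. cell_ball R S t \<theta>')"
  proof
    fix m assume m: "m \<in> F - ?bd"
    then have mc: "m \<in> cells R" and inner: "cell_ball R S m (\<theta> + \<theta>') \<subseteq> F"
      using F(2) cell_ball_self[of m R S]
      by (auto simp: thick_boundary_def inner_part_def outer_part_def)
    obtain t where t: "t \<in> T" "m \<in> cell_ball R S t \<theta>'"
      using T(2) mc by blast
    have "t \<in> cell_ball R S m \<theta>'"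
      using cell_ball_sym[OF R S(2)] t T(1) by blast
    then have "cell_ball R S t \<theta> \<subseteq> F"
      using cell_ball_trans[of t R S m \<theta>'] inner by (auto simp: add.commute)
    then show "m \<in> (\<Union>t\<in>?U. cell_ball R S t \<theta>')" using t by blast
  qed
  then have "card (F - ?bd) \<le> card (\<Union>t\<in>?U. cell_ball R S t \<theta>')"
    using finU by (intro card_mono finite_UN_I finite_cell_ball[OF S(1)])
  also have "\<dots> \<le> (\<Sum>t\<in>?U. card (cell_ball R S t \<theta>'))"
    using finU by (rule card_UN_le)
  also have "\<dots> \<le> card ?U * (\<Sum>k\<le>\<theta>'. card S ^ k)"
    using sum_bounded_above[of ?U "\<lambda>t. card (cell_ball R S t \<theta>')", OF card_cell_ball_le[OF S(1)]]
    by (simp only: of_nat_id)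
  finally have "card (F - ?bd) \<le> card ?U * (\<Sum>k\<le>\<theta>'. card S ^ k)" .
  \<comment> \<open>Finiteness matters because an infinite boundary would have \<open>card\<close> 0
    and the subtraction below would fail.\<close>
  moreover have "finite ?bd"
  proof (rule finite_subset)
    show "?bd \<subseteq> (\<Union>a\<in>F. cell_ball R S a (\<theta> + \<theta>'))"
      using cell_ball_sym[OF R S(2)] by (auto simp: thick_boundary_def outer_part_def)
  qed (simp add: F(1) finite_cell_ball[OF S(1)])
  then have "card F - card ?bd \<le> card (F - ?bd)"
    by (rule diff_card_le_card_Diff)
  ultimately show ?thesis by simp
qed

section \<open>Entropy\<close>

text \<open>By reflexivity every tail contains its starting index. This rules out the degenerate
  limit superior -\<infinity> along the trivial filter.\<close>

lemma tail_filter_neq_bot: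
  assumes "directed_preorder I r" shows "tail_filter I r \<noteq> bot"
proof
  assume "tail_filter I r = bot"
  then have "eventually (\<lambda>_. False) (tail_filter I r)"
    by simp
  then obtain i where "i \<in> I" "\<forall>j\<in>I. (i, j) \<notin> r"
    unfolding eventually_tail_filter[OF assms] by blast
  moreover have "refl_on I r"
    using assms by (simp add: directed_preorder_def preorder_on_def)
  ultimately show False by (meson refl_onD)
qed

lemma eventually_tail_filter_in:
  assumes "directed_preorder I r" shows "\<forall>\<^sub>F i in tail_filter I r. i \<in> I"
proof -
  have "I \<noteq> {}" using assms by (simp add: directed_preorder_def)
  then show ?thesis unfolding eventually_tail_filter[OF assms] by blast
qed

text \<open>Logarithms turn the factor \<open>c ^ k\<close> into \<open>k * ln c\<close>; as
  \<open>ln c\<close> is negative, a lower bound on \<open>k\<close> becomes an upper bound on this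
  term.\<close>

lemma ln_card_le_linear:
  assumes "0 < c" "c < 1" "real (card B) \<le> c ^ k * real (card A)" "\<delta> * real n \<le> real k" "0 < n"
  shows "ln_card B / ereal (real n) \<le> ln_card A / ereal (real n) + ereal (\<delta> * ln c)"
proof (cases "card B = 0")
  case True
  then show ?thesis using assms(5) by (simp add: ln_card_def)
next
  case False
  then have A: "0 < card A"
    using assms(3) by (cases "card A = 0") auto
  have "ln (real (card B)) \<le> ln (c ^ k * real (card A))"
    using False A assms by simp
  also have "\<dots> = real k * ln c + ln (real (card A))"
    using assms(1) A by (simp add: ln_mult ln_realpow)
  also have "real k * ln c \<le> \<delta> * real n * ln c"
    using assms by (intro mult_right_mono_neg) auto
  finally have "ln (real (card B)) / real n \<le> ln (real (card A)) / real n + \<delta> * ln c"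
    using assms(5) by (simp add: field_simps)
  then show ?thesis
    using False A assms(5) by (simp add: ln_card_def)
qed

text \<open>A non-empty \<open>X\<close> has at least one and at most
  \<open>card Q ^ card (F i)\<close> patterns on \<open>F i\<close>. The point is that the entropy
  is a finite number.\<close>

lemma entropy_bounds:
  assumes net: "right_folner_net R S I r F" and Q: "finite Q"
    and X: "X \<subseteq> patterns Q (cells R)" "X \<noteq> {}"
  shows "0 \<le> entropy I r F X" "entropy I r F X \<le> ereal (ln (real (Suc (card Q))))"
proof -
  let ?f = "\<lambda>i. ln_card (restrictions X (F i)) / ereal (real (card (F i)))"
  have dir: "directed_preorder I r"
    using net by (simp add: right_folner_net_def)
  have bounds: "0 \<le> ?f i \<and> ?f i \<le> ereal (ln (real (Suc (card Q))))" if "i \<in> I" for i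
  proof -
    have F: "finite (F i)" "F i \<noteq> {}" "F i \<subseteq> cells R"
      using net that by (auto simp: right_folner_net_def)
    then have cF: "0 < card (F i)" by (simp add: card_gt_0_iff)
    let ?XF = "restrictions X (F i)"
    have sub: "?XF \<subseteq> patterns Q (F i)"
      using X(1) F(3) by (rule restrictions_subset_patterns)
    have "finite ?XF" using finite_restrictions[OF X(1) F(3,1) Q] .
    then have pos: "0 < card ?XF" using X(2) by (auto simp: card_gt_0_iff restrictions_def)
    have "card ?XF \<le> card Q ^ card (F i)"
      using sub card_patterns_le[OF F(1) Q] card_mono le_trans by metis
    also have "\<dots> \<le> Suc (card Q) ^ card (F i)"
      by (intro power_mono) auto
    finally have "real (card ?XF) \<le> real (Suc (card Q)) ^ card (F i)"
      by (metis of_nat_le_iff of_nat_power)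
    then have "ln (real (card ?XF)) \<le> ln (real (Suc (card Q)) ^ card (F i))"
      using pos by (subst ln_le_cancel_iff) auto
    then have "ln (real (card ?XF)) \<le> real (card (F i)) * ln (real (Suc (card Q)))"
      by (simp add: ln_realpow)
    then show ?thesis
      using pos cF by (simp add: ln_card_def field_simps)
  qed
  note ev = eventually_mono[OF eventually_tail_filter_in[OF dir]]
  show "0 \<le> entropy I r F X"
    unfolding entropy_def using tail_filter_neq_bot[OF dir] bounds by (intro le_Limsup ev) auto
  show "entropy I r F X \<le> ereal (ln (real (Suc (card Q))))"
    unfolding entropy_def using bounds by (intro Limsup_bounded ev) auto
qed

lemma entropy_less:
  assumes net: "right_folner_net R S I r F" and Q: "finite Q"
    and X: "X \<subseteq> patterns Q (cells R)" "X \<noteq> {}"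
    and c: "0 < c" "c < 1" and \<delta>: "0 < \<delta>"
    and le: "\<forall>\<^sub>F i in tail_filter I r. \<exists>k. \<delta> * real (card (F i)) \<le> real k \<and>
      real (card (restrictions Y (F i))) \<le> c ^ k * real (card (restrictions X (F i)))"
  shows "entropy I r F Y < entropy I r F X"
proof -
  let ?f = "\<lambda>Z i. ln_card (restrictions Z (F i)) / ereal (real (card (F i)))"
  have dir: "directed_preorder I r"
    using net by (simp add: right_folner_net_def)
  have "\<forall>\<^sub>F i in tail_filter I r. ?f Y i \<le> ?f X i + ereal (\<delta> * ln c)"
    using le eventually_tail_filter_in[OF dir]
  proof eventually_elim
    case (elim i)
    then have "0 < card (F i)"
      using net by (auto simp: right_folner_net_def card_gt_0_iff)
    then show ?case
      using elim(1) ln_card_le_linear[OF c] by blast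
  qed
  then have "entropy I r F Y \<le> Limsup (tail_filter I r) (\<lambda>i. ?f X i + ereal (\<delta> * ln c))"
    unfolding entropy_def by (rule Limsup_mono)
  also have "\<dots> = entropy I r F X + ereal (\<delta> * ln c)"
    unfolding entropy_def by (intro Limsup_add_ereal_right tail_filter_neq_bot[OF dir]) simp
  also have "\<dots> < entropy I r F X"
  proof -
    \<comment> \<open>Strictness rests on finiteness: adding a negative real to an infinite
      \<open>ereal\<close> would leave it unchanged.\<close>
    obtain e where "entropy I r F X = ereal e"
      using entropy_bounds[OF net Q X] by (cases "entropy I r F X") auto
    then show ?thesis using c \<delta> by (simp add: mult_pos_neg)
  qed
  finally show ?thesis .
qed

section \<open>Combining the tile density with the pattern count\<close>

theorem theorem3p10:
  fixes R :: "('g, 'm) cell_data"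
    and S :: "'g set set"
    and H :: "'g set"
    and Q :: "'q set"
    and I :: "'i set"
    and r :: "('i \<times> 'i) set"
    and F :: "'i \<Rightarrow> 'm set"
    and \<theta> \<kappa> \<theta>' :: nat
    and X Y :: "('m \<rightharpoonup> 'q) set"
    and T :: "'m set"
  assumes "cell_space R"
    and "finite (stab R)"
    and "finite S"
    and "symmetric_right_generating R S"
    and "subgroup H (sym_group R)"
    and "\<forall>m\<in>cells R. coord R m \<in> H"
    and "finite Q"
    and "right_amenable R"
    and "right_folner_net R S I r F"
    and "subshift R H Q X"
    and "strongly_irreducible R S H Q \<kappa> X"
    and "infinite X \<or> 2 \<le> card X"
    and "Y \<subseteq> X"
    and "is_tiling R S \<theta> \<kappa> \<theta>' T"
    and "\<forall>t\<in>T. restrictions Y (cell_ball R S t \<theta>) \<subset> restrictions X (cell_ball R S t \<theta>)"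
  shows "entropy I r F Y < entropy I r F X"
proof -
  note R = assms(1) and S = assms(3,4) and H = assms(5) and Q = assms(7) and net = assms(9)
  let ?D = "\<lambda>t. cell_ball R S t \<theta>"
  \<comment> \<open>\<open>b\<close> bounds the \<open>\<theta>'\<close>-balls, and \<open>n\<close>
    the \<open>\<kappa>\<close>-neighbourhoods of tiles, which lie in balls of radius
    \<open>\<theta> + \<kappa>\<close>. The 2 in \<open>\<delta>\<close> allows for the boundary
    taking up half of \<open>F i\<close>.\<close>
  define b where "b = (\<Sum>k\<le>\<theta>'. card S ^ k)"
  define n where "n = (\<Sum>k\<le>\<theta> + \<kappa>. card S ^ k)"
  define c where "c = 1 - 1 / (real (Suc (card Q)) ^ n + 1)"
  define \<delta> where "\<delta> = 1 / (2 * real b)"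
  have "X \<noteq> {}"
    using assms(12) by auto
  then have X: "X \<subseteq> patterns Q (cells R)" "X \<noteq> {}"
    using assms(10) by (auto simp: subshift_def shift_avoiding_def)
  have T: "T \<subseteq> cells R" "(\<Union>t\<in>T. cell_ball R S t \<theta>') = cells R"
    and far: "\<And>t t'. t \<in> T \<Longrightarrow> t' \<in> T \<Longrightarrow> t \<noteq> t' \<Longrightarrow> enat (\<kappa> + 1) \<le> set_dist R S (?D t) (?D t')"
    using assms(14) by (auto simp: is_tiling_def)
  have c: "0 < c" "c < 1"
    by (auto simp: c_def field_simps add_pos_pos)
  \<comment> \<open>The summand for \<open>k = 0\<close> is 1, so \<open>b\<close> is positive even
    if \<open>S\<close> is empty.\<close>
  have "card S ^ 0 \<le> b"
    unfolding b_def by (intro member_le_sum) auto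
  then have b: "0 < b" by simp
  have "\<forall>t\<in>T. \<exists>p. p \<in> restrictions X (?D t) - restrictions Y (?D t)"
    using assms(15) by blast
  then obtain p where p: "\<And>t. t \<in> T \<Longrightarrow> p t \<in> restrictions X (?D t)"
      "\<And>t. t \<in> T \<Longrightarrow> p t \<notin> restrictions Y (?D t)"
    by (metis DiffE)
  have hood: "card (\<Union>a\<in>?D t. cell_ball R S a \<kappa>) \<le> n" for t
  proof -
    have "card (\<Union>a\<in>?D t. cell_ball R S a \<kappa>) \<le> card (cell_ball R S t (\<theta> + \<kappa>))"
      using S(1) cell_ball_trans[of _ R S t \<theta>] by (intro card_mono finite_cell_ball) auto
    also have "\<dots> \<le> n"
      unfolding n_def using S(1) by (rule card_cell_ball_le)
    finally show ?thesis .
  qed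
  have dir: "directed_preorder I r"
    using net by (simp add: right_folner_net_def)
  \<comment> \<open>The Folner condition is applied with radius \<open>\<theta> + \<theta>'\<close>,
    as in the covering estimate.\<close>
  have "\<forall>\<^sub>F i in tail_filter I r.
      real (card (thick_boundary R S (\<theta> + \<theta>') (F i))) / real (card (F i)) < 1 / 2"
    using net by (intro order_tendstoD(2)[where y = 0]) (auto simp: right_folner_net_def)
  then have "\<forall>\<^sub>F i in tail_filter I r. \<exists>k. \<delta> * real (card (F i)) \<le> real k \<and>
      real (card (restrictions Y (F i))) \<le> c ^ k * real (card (restrictions X (F i)))"
    using eventually_tail_filter_in[OF dir]
  proof eventually_elim
    case (elim i)
    let ?U = "{t \<in> T. ?D t \<subseteq> F i}" and ?bd = "thick_boundary R S (\<theta> + \<theta>') (F i)"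
    let ?A = "{x \<in> X. \<forall>t\<in>?U. x |` ?D t \<noteq> p t}"
    have Fi: "finite (F i)" "F i \<subseteq> cells R" "0 < card (F i)"
      using net elim(2) by (auto simp: right_folner_net_def card_gt_0_iff)
    have U: "finite ?U"
      using T(1) cell_ball_self[of _ R S \<theta>] by (intro finite_subset[OF _ Fi(1)]) blast
    have "real (card (F i)) \<le> real (card ?U) * real b + real (card ?bd)"
      using card_minus_boundary_le_tiles[OF R S T Fi(1,2), of \<theta>] unfolding b_def
      by (metis of_nat_le_iff of_nat_add of_nat_mult)
    moreover have "real (card ?bd) \<le> real (card (F i)) / 2"
      using elim(1) Fi(3) by (simp add: field_simps)
    \<comment> \<open>At least half of \<open>F i\<close> is accounted for by the tiles in
      \<open>?U\<close>, each contributing at most \<open>b\<close> cells.\<close>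
    ultimately have dens: "\<delta> * real (card (F i)) \<le> real (card ?U)"
      using b by (simp add: \<delta>_def field_simps)
    have "finite (restrictions ?A (F i))"
      using X(1) by (intro finite_restrictions[OF _ Fi(2,1) Q]) blast
    moreover have "restrictions Y (F i) \<subseteq> restrictions ?A (F i)"
    proof -
      have "Y \<subseteq> ?A"
      proof
        fix y assume y: "y \<in> Y"
        then have "y |` ?D t \<noteq> p t" if "t \<in> T" for t
          using p(2)[OF that] unfolding restrictions_def by (metis imageI)
        then show "y \<in> ?A" using y assms(13) by simp blast
      qed
      then show ?thesis unfolding restrictions_def by (rule image_mono)
    qed
    ultimately have "card (restrictions Y (F i)) \<le> card (restrictions ?A (F i))"
      by (rule card_mono)
    also have "real (card (restrictions ?A (F i))) \<le> c ^ card ?U * real (card (restrictions X (F i)))"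
      unfolding c_def
    proof (rule card_restrictions_avoiding_le[OF R S(1) H Q X(1) assms(11) Fi(1,2) U])
    qed (simp_all add: hood far[simplified] p(1))
    finally show ?case using dens by auto
  qed
  then show ?thesis
    using b by (intro entropy_less[OF net Q X c, of \<delta>]) (auto simp: \<delta>_def)
qed

end
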